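(* Set $P_n(m)=2\operatorname{Re}\big(C(m+in)\big)$ for $m+in\in\mathbb Z^2_+$, where $C$ is the discrete Cauchy kernel. Then for every $1\leqslant p<\infty$ and every $f\in H^p$, $$f(m+in)=\sum_{j=-\infty}^{+\infty}f(j)\,P_n(m-j),\qquad m+in\in\mathbb Z^2_+.$$
   Context: Lattice points $(m,n)\in\mathbb Z^2$ are identified with $m+in\in\mathbb C$. Let $\mathbb Z^2_+=\{m+in: m,n\in\mathbb Z,\ n\geqslant 0\}$. A function $f:\mathbb Z^2_+\to\mathbb C$ is discrete holomorphic, written $f\in\operatorname{Hol}(\mathbb Z^2_+)$, if $f(z)+i f(z+1)-f(z+1+i)-i f(z+i)=0$ for every $z\in\mathbb Z^2_+$. For $1\leqslant p\leqslant\infty$, $H^p=H^p(\mathbb Z^2_+)=\{f\in\operatorname{Hol}(\mathbb Z^2_+): \|f\|_{H^p}:=\sup_{n\geqslant 0}\|f(\cdot+in)\|_{\ell^p(\mathbb Z)}<\infty\}$. The discrete Cauchy kernel on $\mathbb Z^2_+$ is $C(m+in)=\frac1{2\pi}\int_0^\pi e^{imt}\left(\frac{\cos t}{1+\sin t}\right)^n dt$, $m\in\mathbb Z$, $n\geqslant 0$. *)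

theory Defs
  imports "HOL-Analysis.Analysis"
begin

text \<open>
  The lattice point \<open>m + i n\<close> of the upper half-plane, with \<open>m\<close> an integer and \<open>n \<ge> 0\<close>,
  is represented by the pair of arguments \<open>m :: int\<close> and \<open>n :: nat\<close>. Thus \<open>z + 1\<close>
  is \<open>(m + 1, n)\<close> and \<open>z + i\<close> is \<open>(m, n + 1)\<close>.
\<close>

definition Hol_Z2_plus :: "(int \<Rightarrow> nat \<Rightarrow> complex) set" where
  "Hol_Z2_plus =
     {f. \<forall>m n. f m n + \<i> * f (m + 1) n - f (m + 1) (n + 1) - \<i> * f m (n + 1) = 0}"

text \<open>
  The norm takes the value \<open>\<infinity>\<close> on sequences outside \<open>\<ell>\<^sup>p\<close>. It is meant for \<open>1 \<le> p < \<infinity>\<close>.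
\<close>

definition lp_norm :: "real \<Rightarrow> (int \<Rightarrow> complex) \<Rightarrow> ennreal" where
  "lp_norm p a =
     (if (\<lambda>m. norm (a m) powr p) summable_on UNIV
      then ennreal ((\<Sum>\<^sub>\<infinity>m. norm (a m) powr p) powr (1 / p))
      else \<infinity>)"

definition Hp_norm :: "real \<Rightarrow> (int \<Rightarrow> nat \<Rightarrow> complex) \<Rightarrow> ennreal" where
  "Hp_norm p f = (SUP n. lp_norm p (\<lambda>m. f m n))"

definition Hp :: "real \<Rightarrow> (int \<Rightarrow> nat \<Rightarrow> complex) set" where
  "Hp p = {f \<in> Hol_Z2_plus. Hp_norm p f < \<infinity>}"

definition discrete_cauchy_kernel :: "int \<Rightarrow> nat \<Rightarrow> complex" where
  "discrete_cauchy_kernel m n =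
     1 / (2 * of_real pi) *
       integral {0..pi}
         (\<lambda>t::real. exp (\<i> * of_int m * of_real t) * of_real ((cos t / (1 + sin t)) ^ n))"

definition discrete_poisson_kernel :: "nat \<Rightarrow> int \<Rightarrow> real" where
  "discrete_poisson_kernel n m = 2 * Re (discrete_cauchy_kernel m n)"

end

theory Submission
  imports Defs "HOL-Real_Asymp.Real_Asymp"
begin

text \<open>
  Both \<open>f\<close> and the Poisson kernel are harmonic for the random walk on the half-plane with steps
  \<open>\<plusminus>1 \<plusminus> i\<close>. Comparison with the harmonic functions \<open>n\<close> and \<open>m\<^sup>2 - n\<^sup>2\<close> shows that a bounded
  harmonic function with nonnegative boundary values is nonnegative. Since \<open>P\<^sub>0\<close> is the indicator
  of the origin, it follows that \<open>P\<^sub>n \<ge> 0\<close> and \<open>\<Sum>\<^sub>m P\<^sub>n(m) \<le> 1\<close>. As \<open>f\<close> is bounded,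
  the Poisson integral of \<open>f(\<cdot>, 0)\<close> is then a bounded harmonic function with the boundary values
  of \<open>f\<close>, so that it equals \<open>f\<close>.
\<close>

section \<open>Harmonic functions of the diagonal random walk\<close>

text \<open>Mean value property over the four diagonal neighbours. The centre has height
  \<open>Suc n\<close>, so nothing is required at points of the boundary row; multiplying by 4
  instead of dividing lets the same notion serve real and complex functions.\<close>

definition diag_harmonic :: "(int \<Rightarrow> nat \<Rightarrow> 'a::semiring_1) \<Rightarrow> bool" where
  "diag_harmonic u \<longleftrightarrow> (\<forall>m n. u (m + 1) (Suc (Suc n)) + u (m - 1) (Suc (Suc n))
     + u (m + 1) n + u (m - 1) n = 4 * u m (Suc n))"

lemma diag_harmonicD:
  "diag_harmonic u \<Longrightarrow> u (m + 1) (Suc (Suc n)) + u (m - 1) (Suc (Suc n))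
     + u (m + 1) n + u (m - 1) n = 4 * u m (Suc n)"
  by (simp add: diag_harmonic_def)

lemma diag_harmonic_add:
  assumes "diag_harmonic u" "diag_harmonic v"
  shows "diag_harmonic (\<lambda>m n. u m n + v m n)"
  unfolding diag_harmonic_def
proof (intro allI)
  fix m n
  show "u (m + 1) (Suc (Suc n)) + v (m + 1) (Suc (Suc n))
     + (u (m - 1) (Suc (Suc n)) + v (m - 1) (Suc (Suc n)))
     + (u (m + 1) n + v (m + 1) n) + (u (m - 1) n + v (m - 1) n) = 4 * (u m (Suc n) + v m (Suc n))"
    unfolding distrib_left diag_harmonicD[OF assms(1), symmetric]
      diag_harmonicD[OF assms(2), symmetric]
    by (simp only: ac_simps)
qed

lemma diag_harmonic_cmult:
  fixes u :: "int \<Rightarrow> nat \<Rightarrow> 'a::comm_semiring_1"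
  assumes "diag_harmonic u"
  shows "diag_harmonic (\<lambda>m n. c * u m n)"
  unfolding diag_harmonic_def
  by (simp only: distrib_left[symmetric] diag_harmonicD[OF assms]) (simp only: mult.left_commute simp_thms)

lemma diag_harmonic_diff:
  fixes u :: "int \<Rightarrow> nat \<Rightarrow> 'a::comm_ring_1"
  assumes "diag_harmonic u" "diag_harmonic v"
  shows "diag_harmonic (\<lambda>m n. u m n - v m n)"
  using diag_harmonic_add[OF assms(1) diag_harmonic_cmult[OF assms(2), of "-1"]] by simp

lemma diag_harmonic_const: "diag_harmonic (\<lambda>m n. c)"
proof -
  have "c + c + c + c = (1 + 1 + 1 + 1) * c"
    by (simp only: distrib_right mult_1_left)
  then show ?thesis
    by (simp add: diag_harmonic_def)
qed

lemma diag_harmonic_sum: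
  fixes u :: "'i \<Rightarrow> int \<Rightarrow> nat \<Rightarrow> 'a::semiring_1"
  assumes "\<And>i. i \<in> I \<Longrightarrow> diag_harmonic (u i)"
  shows "diag_harmonic (\<lambda>m n. \<Sum>i\<in>I. u i m n)"
  using assms
proof (induction I rule: infinite_finite_induct)
  case (insert i I)
  then show ?case
    by (simp add: diag_harmonic_add)
qed (simp_all add: diag_harmonic_const)

lemma diag_harmonic_translate: "diag_harmonic u \<Longrightarrow> diag_harmonic (\<lambda>m n. u (m - k) n)"
  unfolding diag_harmonic_def
proof (intro allI)
  fix m n
  assume "\<forall>m n. u (m + 1) (Suc (Suc n)) + u (m - 1) (Suc (Suc n))
     + u (m + 1) n + u (m - 1) n = 4 * u m (Suc n)"
  from this[rule_format, of "m - k" n]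
  show "u (m + 1 - k) (Suc (Suc n)) + u (m - 1 - k) (Suc (Suc n))
     + u (m + 1 - k) n + u (m - 1 - k) n = 4 * u (m - k) (Suc n)"
    by (simp add: algebra_simps)
qed

lemma diag_harmonic_Re: "diag_harmonic u \<Longrightarrow> diag_harmonic (\<lambda>m n. Re (u m n))"
  unfolding diag_harmonic_def
proof (intro allI)
  fix m n
  assume "\<forall>m n. u (m + 1) (Suc (Suc n)) + u (m - 1) (Suc (Suc n))
     + u (m + 1) n + u (m - 1) n = 4 * u m (Suc n)"
  from arg_cong[OF this[rule_format, of m n], of Re]
  show "Re (u (m + 1) (Suc (Suc n))) + Re (u (m - 1) (Suc (Suc n)))
     + Re (u (m + 1) n) + Re (u (m - 1) n) = 4 * Re (u m (Suc n))"
    by simp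
qed

section \<open>Minimum principle and uniqueness in the half-plane\<close>

text \<open>At a negative minimum in the highest row where it is attained, both upper neighbours are
  strictly larger and both lower ones at least as large, which contradicts the mean value
  property.\<close>

lemma diag_harmonic_box_nonneg:
  fixes u :: "int \<Rightarrow> nat \<Rightarrow> real"
  assumes harm: "diag_harmonic u"
    and bottom: "\<And>m. u m 0 \<ge> 0"
    and top: "\<And>m. \<bar>m\<bar> \<le> M \<Longrightarrow> u m N \<ge> 0"
    and sides: "\<And>m n. \<bar>m\<bar> = M \<Longrightarrow> n \<le> N \<Longrightarrow> u m n \<ge> 0"
    and "\<bar>m\<bar> \<le> M" "n \<le> N"
  shows "u m n \<ge> 0"
proof (rule ccontr)
  assume neg: "\<not> u m n \<ge> 0"
  define D where "D = {-M..M} \<times> {..N}"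
  define a where "a = Min ((\<lambda>(m, n). u m n) ` D)"
  have fin: "finite D" and mn: "(m, n) \<in> D"
    using assms(5,6) by (auto simp: D_def)
  have a_le: "a \<le> u k l" if "(k, l) \<in> D" for k l
    unfolding a_def using fin that by (intro Min_le) (auto intro!: image_eqI[of _ _ "(k, l)"])
  have "a < 0"
    using a_le[OF mn] neg by linarith
  \<comment> \<open>Rows of the box in which the minimum \<open>a\<close> occurs; the topmost,
    \<open>Max L\<close>, makes the inequality at the upper neighbours strict.\<close>
  define L where "L = {l. \<exists>k. (k, l) \<in> D \<and> u k l = a}"
  have "L \<subseteq> {..N}"
    by (auto simp: L_def D_def)
  then have finL: "finite L"
    by (rule finite_subset) simp
  have "a \<in> (\<lambda>(m, n). u m n) ` D"
    unfolding a_def using fin mn by (intro Min_in) auto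
  then have "L \<noteq> {}"
    by (auto simp: L_def)
  then have "Max L \<in> L"
    using finL by (rule Max_in[rotated])
  then obtain k where k: "(k, Max L) \<in> D" "u k (Max L) = a"
    by (auto simp: L_def)
  \<comment> \<open>On the edges of the box \<open>u\<close> is nonnegative, hence never equal to
    \<open>a < 0\<close>; so all four diagonal neighbours of the minimum point lie in the
    box.\<close>
  have "Max L \<noteq> 0" "Max L \<noteq> N" "\<bar>k\<bar> \<noteq> M"
    using bottom[of k] top[of k] sides[of k "Max L"] k \<open>a < 0\<close>
    by (metis D_def atLeastAtMost_iff abs_le_iff atMost_iff linorder_not_less mem_Sigma_iff minus_le_iff)+
  then obtain l where l: "Max L = Suc l" "Suc (Suc l) \<le> N" and kM: "\<bar>k\<bar> < M"
    using k by (cases "Max L") (auto simp: D_def)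
  have strict: "u k' (Suc (Suc l)) > a" if "\<bar>k'\<bar> \<le> M" for k'
  proof -
    have "(k', Suc (Suc l)) \<in> D"
      using that l by (auto simp: D_def)
    moreover have "Suc (Suc l) \<notin> L"
      using Max_ge[OF finL, of "Suc (Suc l)"] l by auto
    ultimately show ?thesis
      using a_le[of k' "Suc (Suc l)"] by (force simp: L_def)
  qed
  have "u (k + 1) (Suc (Suc l)) > a" "u (k - 1) (Suc (Suc l)) > a"
    using kM by (auto intro!: strict)
  moreover have "u (k + 1) l \<ge> a" "u (k - 1) l \<ge> a"
    using kM l by (auto intro!: a_le simp: D_def)
  moreover have "u k (Suc l) = a"
    using k l by simp
  ultimately show False
    using diag_harmonicD[OF harm, of k l] by linarith
qed

text \<open>Source of the comparison functions: the height \<open>n\<close>, and the real part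
  \<open>m^2 - n^2\<close> of the square of \<open>m + i n\<close>, shifted by a constant.\<close>

lemma diag_harmonic_barrier:
  "diag_harmonic (\<lambda>m n. a * real n + b * ((real_of_int m)\<^sup>2 + c - (real n)\<^sup>2))"
  by (simp add: diag_harmonic_def algebra_simps power2_eq_square)

text \<open>A Phragmen-Lindelof argument: a barrier offsets the lower bound on the far edges of a
  box, and tends to 0 at each fixed point as the box first widens and then grows in height.\<close>

lemma diag_harmonic_nonneg:
  fixes u :: "int \<Rightarrow> nat \<Rightarrow> real"
  assumes harm: "diag_harmonic u"
    and bound: "\<And>m n. u m n \<ge> - B"
    and bottom: "\<And>m. u m 0 \<ge> 0"
  shows "u m n \<ge> 0"
proof -
  define b where "b = \<bar>B\<bar>"
  have b: "b \<ge> 0" "\<And>m n. u m n + b \<ge> 0"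
    using bound by (auto simp: b_def) (smt (verit) bound)
  \<comment> \<open>The linear term equals \<open>b\<close> on the top edge \<open>n = N\<close>;
    the quadratic term is at least \<open>b\<close> on the sides \<open>\<bar>m\<bar> = M\<close>.
    Adding \<open>N^2\<close> keeps the quadratic term nonnegative for all
    \<open>n \<le> N\<close>.\<close>
  define w where "w M N m n = b / real N * real n
      + b / (real M)\<^sup>2 * ((real_of_int m)\<^sup>2 + (real N)\<^sup>2 - (real n)\<^sup>2)" for M N :: nat and m n
  have box: "u m n + w M N m n \<ge> 0"
    if M: "M > 0" "\<bar>m\<bar> \<le> int M" and N: "N > 0" "n \<le> N" for M N
  proof (rule diag_harmonic_box_nonneg[where u = "\<lambda>m n. u m n + w M N m n" and M = "int M" and N = N])
    have *: "(real n)\<^sup>2 \<le> (real N)\<^sup>2" if "n \<le> N" for n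
      using that by (intro power_mono) auto
    have side: "w M N m n \<ge> b" if "\<bar>m\<bar> = int M" "n \<le> N" for m n
    proof -
      have m2: "(real_of_int m)\<^sup>2 = (real M)\<^sup>2"
        using that(1) by (metis of_int_abs of_int_of_nat_eq power2_abs)
      have "b = b / (real M)\<^sup>2 * (real M)\<^sup>2"
        using M by simp
      also have "\<dots> \<le> b / (real M)\<^sup>2 * ((real_of_int m)\<^sup>2 + (real N)\<^sup>2 - (real n)\<^sup>2)"
        using *[OF that(2)] m2 b by (intro mult_left_mono) auto
      finally show ?thesis
        using b by (simp add: w_def add_increasing)
    qed
    show "diag_harmonic (\<lambda>m n. u m n + w M N m n)"
      unfolding w_def by (intro diag_harmonic_add harm diag_harmonic_barrier)
    show "u m 0 + w M N m 0 \<ge> 0" for m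
      using bottom[of m] b by (simp add: w_def)
    show "u m N + w M N m N \<ge> 0" for m
      using b(2)[of m N] b(1) N by (simp add: w_def add_increasing2 add.assoc[symmetric])
    show "u m n + w M N m n \<ge> 0" if "\<bar>m\<bar> = int M" "n \<le> N" for m n
      using side[OF that] b(2)[of m n] by linarith
  qed (use that in auto)
  \<comment> \<open>With \<open>N\<close> fixed, \<open>M\<close> tends to infinity and the
    quadratic term disappears.\<close>
  have strip: "u m n + b / real N * real n \<ge> 0" if N: "N > 0" "n \<le> N" for N
  proof (rule tendsto_lowerbound)
    have "(\<lambda>M. b / (real M)\<^sup>2) \<longlonglongrightarrow> 0"
      by real_asymp
    from tendsto_add[OF tendsto_const tendsto_mult_left_zero[OF this]]
    show "(\<lambda>M. u m n + b / real N * real n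
        + b / (real M)\<^sup>2 * ((real_of_int m)\<^sup>2 + (real N)\<^sup>2 - (real n)\<^sup>2))
        \<longlonglongrightarrow> u m n + b / real N * real n"
      by fastforce
    show "\<forall>\<^sub>F M in sequentially. 0 \<le> u m n + b / real N * real n
        + b / (real M)\<^sup>2 * ((real_of_int m)\<^sup>2 + (real N)\<^sup>2 - (real n)\<^sup>2)"
      using eventually_ge_at_top[of "Suc (nat \<bar>m\<bar>)"]
    proof eventually_elim
      case (elim M)
      then show ?case
        using box[of M N] N by (simp add: w_def add.assoc)
    qed
  qed simp
  \<comment> \<open>Now \<open>N\<close> tends to infinity, which removes the linear term.\<close>
  show ?thesis
  proof (rule tendsto_lowerbound)
    have "(\<lambda>N. b / real N * real n) \<longlonglongrightarrow> 0"
      by real_asymp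
    from tendsto_add[OF tendsto_const this]
    show "(\<lambda>N. u m n + b / real N * real n) \<longlonglongrightarrow> u m n"
      by fastforce
    show "\<forall>\<^sub>F N in sequentially. 0 \<le> u m n + b / real N * real n"
      using eventually_ge_at_top[of "Suc n"] by eventually_elim (rule strip, auto)
  qed simp
qed

text \<open>Each rotation \<open>c * u\<close> has a bounded harmonic real part with zero boundary
  values. The choices \<open>c = 1, -1, \<i>, -\<i>\<close> bound the real and imaginary parts of
  \<open>u\<close> from both sides by 0.\<close>

lemma diag_harmonic_eq_0:
  fixes u :: "int \<Rightarrow> nat \<Rightarrow> complex"
  assumes harm: "diag_harmonic u"
    and bound: "\<And>m n. norm (u m n) \<le> B"
    and bottom: "\<And>m. u m 0 = 0"
  shows "u m n = 0"
proof -
  have nonneg: "Re (c * u m n) \<ge> 0" if "norm c = 1" for c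
  proof (rule diag_harmonic_nonneg[where u = "\<lambda>m n. Re (c * u m n)" and B = B])
    show "diag_harmonic (\<lambda>m n. Re (c * u m n))"
      by (intro diag_harmonic_Re diag_harmonic_cmult harm)
    show "- B \<le> Re (c * u m n)" for m n
      using abs_Re_le_cmod[of "c * u m n"] bound[of m n] that by (simp add: norm_mult)
  qed (simp add: bottom)
  show ?thesis
    using nonneg[of 1] nonneg[of "-1"] nonneg[of \<i>] nonneg[of "-\<i>"] by (simp add: complex_eq_iff)
qed

section \<open>Harmonicity and boundedness of functions in \<open>Hp\<close>\<close>

text \<open>Each of the four unit squares around the centre expresses one diagonal neighbour as the
  central value plus \<open>\<i>\<close> times a difference of two adjacent values. These
  differences cancel in the sum.\<close>

lemma Hol_Z2_plus_diag_harmonic: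
  assumes "f \<in> Hol_Z2_plus"
  shows "diag_harmonic f"
  unfolding diag_harmonic_def
proof (intro allI)
  fix m n
  \<comment> \<open>For the square with lower left corner \<open>(a, b)\<close>, \<open>R\<close>
    solves for the upper right corner and \<open>R'\<close> isolates the upper left one.\<close>
  have R: "f (a + 1) (Suc b) = f a b + \<i> * f (a + 1) b - \<i> * f a (Suc b)" for a b
    using assms[unfolded Hol_Z2_plus_def mem_Collect_eq, rule_format, of a b]
    unfolding Suc_eq_plus1 by (simp add: algebra_simps)
  have R': "\<i> * f a (Suc b) = f a b + \<i> * f (a + 1) b - f (a + 1) (Suc b)" for a b
    using R[of a b] by (simp add: algebra_simps)
  have "f (m - 1) (Suc (Suc n)) = - \<i> * (\<i> * f (m - 1) (Suc (Suc n)))"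
    by simp
  also have "\<dots> = - \<i> * f (m - 1) (Suc n) + f m (Suc n) + \<i> * f m (Suc (Suc n))"
    unfolding R'[of "m - 1" "Suc n"] by (simp add: algebra_simps)
  finally have 1: "f (m - 1) (Suc (Suc n)) = \<dots>" .
  have "f (m + 1) n = - \<i> * (\<i> * f (m + 1) n)"
    by simp
  also have "\<dots> = - \<i> * (f (m + 1) (Suc n) + \<i> * f m (Suc n) - f m n)"
    by (subst R) (simp add: algebra_simps)
  finally have 2: "f (m + 1) n = - \<i> * f (m + 1) (Suc n) + f m (Suc n) + \<i> * f m n"
    by (simp add: algebra_simps)
  have 3: "f (m - 1) n = f m (Suc n) - \<i> * f m n + \<i> * f (m - 1) (Suc n)"
    using R[of "m - 1" n] by (simp add: algebra_simps)
  show "f (m + 1) (Suc (Suc n)) + f (m - 1) (Suc (Suc n)) + f (m + 1) n + f (m - 1) n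
      = 4 * f m (Suc n)"
    unfolding 1 2 3 R[of m "Suc n"] by (simp add: algebra_simps)
qed

text \<open>A single term is at most the whole series, so the sup norm of each row is dominated by
  its \<open>p\<close>-norm, uniformly in the row.\<close>

lemma Hp_bounded:
  assumes "p \<ge> 1" and "f \<in> Hp p"
  obtains B where "\<And>m n. norm (f m n) \<le> B"
proof -
  from assms(2) have fin: "Hp_norm p f < \<infinity>"
    by (simp add: Hp_def)
  have "norm (f m n) \<le> enn2real (Hp_norm p f)" for m n
  proof -
    define S where "S = (\<Sum>\<^sub>\<infinity>m. norm (f m n) powr p)"
    have le: "lp_norm p (\<lambda>m. f m n) \<le> Hp_norm p f"
      unfolding Hp_norm_def by (intro SUP_upper) simp
    \<comment> \<open>\<open>lp_norm\<close> is infinite on non-summable sequences, so finiteness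
      forces summability.\<close>
    then have sum: "(\<lambda>m. norm (f m n) powr p) summable_on UNIV"
      using fin by (auto simp: lp_norm_def split: if_splits)
    then have "norm (f m n) powr p \<le> S"
      unfolding S_def using infsum_mono2[of "\<lambda>m. norm (f m n) powr p" "{m}" UNIV] by simp
    then have "(norm (f m n) powr p) powr (1 / p) \<le> S powr (1 / p)"
      using assms(1) by (intro powr_mono2) auto
    then have "norm (f m n) \<le> S powr (1 / p)"
      using assms(1) by (simp add: powr_powr)
    also have "\<dots> = enn2real (lp_norm p (\<lambda>m. f m n))"
      using sum by (simp add: lp_norm_def S_def)
    also have "\<dots> \<le> enn2real (Hp_norm p f)"
      using le fin by (intro enn2real_mono) auto
    finally show ?thesis .
  qed
  then show ?thesis
    using that by blast
qed

section \<open>The Poisson kernel: integral formula, boundary values, harmonicity\<close>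

lemma poisson_integrand_continuous:
  "continuous_on {0..pi} (\<lambda>t. cos (of_int m * t) * (cos t / (1 + sin t)) ^ n)"
proof -
  have "1 + sin t \<noteq> 0" if "t \<in> {0..pi}" for t :: real
    using sin_ge_zero[of t] that by auto
  then show ?thesis
    by (intro continuous_intros) auto
qed

lemma discrete_poisson_kernel_has_integral:
  "((\<lambda>t. cos (of_int m * t) * (cos t / (1 + sin t)) ^ n) has_integral
     pi * discrete_poisson_kernel n m) {0..pi}"
proof -
  define F where "F t = exp (\<i> * of_int m * of_real t) * of_real ((cos t / (1 + sin t)) ^ n)" for t :: real
  have "1 + sin t \<noteq> 0" if "t \<in> {0..pi}" for t :: real
    using sin_ge_zero[of t] that by auto
  then have "continuous_on {0..pi} F"
    unfolding F_def by (intro continuous_intros) auto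
  then have "(F has_integral integral {0..pi} F) {0..pi}"
    by (intro integrable_integral integrable_continuous_real)
  from has_integral_linear[OF this bounded_linear_Re]
  have "((\<lambda>t. Re (F t)) has_integral Re (integral {0..pi} F)) {0..pi}"
    by (simp add: o_def)
  moreover have "Re (F t) = cos (of_int m * t) * (cos t / (1 + sin t)) ^ n" for t
    unfolding F_def by (simp add: Re_exp del: of_real_power of_real_divide)
  moreover have "discrete_cauchy_kernel m n = of_real (1 / (2 * pi)) * integral {0..pi} F"
    unfolding discrete_cauchy_kernel_def F_def by simp
  then have "Re (integral {0..pi} F) = pi * discrete_poisson_kernel n m"
    unfolding discrete_poisson_kernel_def by (simp del: of_real_divide)
  ultimately show ?thesis
    by simp
qed

lemma discrete_poisson_kernel_eq:
  "discrete_poisson_kernel n m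
     = 1 / pi * integral {0..pi} (\<lambda>t. cos (of_int m * t) * (cos t / (1 + sin t)) ^ n)"
  using integral_unique[OF discrete_poisson_kernel_has_integral[of m n]] by simp

text \<open>On \<open>{0..pi}\<close> the sine is nonnegative, so \<bar>cos t\<bar> \<le> 1 \<le> 1
  + sin t and the integrand is at most 1 in absolute value.\<close>

lemma discrete_poisson_kernel_bounded: "\<bar>discrete_poisson_kernel n m\<bar> \<le> 1"
proof -
  have "norm (pi * discrete_poisson_kernel n m) \<le> 1 * measure lborel (cbox 0 pi)"
  proof (rule has_integral_bound)
    fix t :: real
    assume "t \<in> cbox 0 pi"
    then have "sin t \<ge> 0"
      using sin_ge_zero[of t] by auto
    then have "\<bar>cos t / (1 + sin t)\<bar> \<le> 1"
      using order_trans[OF abs_cos_le_one, of "1 + sin t" t] by (simp add: divide_le_eq)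
    then have "\<bar>cos t / (1 + sin t)\<bar> ^ n \<le> 1"
      by (intro power_le_one) auto
    then show "norm (cos (of_int m * t) * (cos t / (1 + sin t)) ^ n) \<le> 1"
      unfolding real_norm_def abs_mult power_abs by (intro mult_le_one) auto
  qed (use discrete_poisson_kernel_has_integral[of m n] in simp_all)
  then show ?thesis
    by (simp add: abs_mult)
qed

text \<open>For \<open>m \<noteq> 0\<close> the antiderivative \<open>sin (m t) / m\<close> vanishes
  at both endpoints.\<close>

lemma discrete_poisson_kernel_0: "discrete_poisson_kernel 0 m = (if m = 0 then 1 else 0)"
proof (cases "m = 0")
  case False
  have "((\<lambda>t. cos (of_int m * t)) has_integral
      sin (of_int m * pi) / of_int m - sin (of_int m * 0) / of_int m) {0..pi}"
    by (intro fundamental_theorem_of_calculus)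
      (use False in \<open>auto intro!: derivative_eq_intros simp: has_real_derivative_iff_has_vector_derivative[symmetric]\<close>)
  moreover have "sin (of_int m * pi) = 0"
    using sin_zero_iff_int2 by blast
  ultimately show ?thesis
    using False has_integral_unique[OF discrete_poisson_kernel_has_integral[of m 0]] by force
qed (simp add: discrete_poisson_kernel_eq)

text \<open>The integrand itself is harmonic for every \<open>t\<close>: with
  \<open>q = cos t / (1 + sin t)\<close> one has \<open>cos t * (q^2 + 1) = 2 * q\<close>, and the
  two horizontal shifts combine to \<open>2 * cos (m t) * cos t\<close>.\<close>

lemma diag_harmonic_discrete_poisson_kernel: "diag_harmonic (\<lambda>m n. discrete_poisson_kernel n m)"
  unfolding diag_harmonic_def
proof (intro allI)
  fix m :: int and n
  define I where "I m n t = cos (of_int m * t) * (cos t / (1 + sin t)) ^ n" for m :: int and n and t :: real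
  note P = discrete_poisson_kernel_has_integral[folded I_def]
  have eq: "I (m + 1) (Suc (Suc n)) t + I (m - 1) (Suc (Suc n)) t + I (m + 1) n t + I (m - 1) n t
      = 4 * I m (Suc n) t" if "t \<in> {0..pi}" for t
  proof -
    define q where "q = cos t / (1 + sin t)"
    have nz: "1 + sin t \<noteq> 0"
      using sin_ge_zero[of t] that by auto
    have sq: "(cos t)\<^sup>2 + (1 + sin t)\<^sup>2 = 2 * (1 + sin t)"
      using sin_cos_squared_add2[of t] by (simp add: power2_eq_square algebra_simps)
    have "q\<^sup>2 + 1 = ((cos t)\<^sup>2 + (1 + sin t)\<^sup>2) / (1 + sin t)\<^sup>2"
      using nz by (simp add: q_def power_divide add_divide_distrib)
    also have "\<dots> = 2 / (1 + sin t)"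
      unfolding sq unfolding power2_eq_square using nz by (rule nonzero_mult_divide_mult_cancel_right)
    finally have q: "cos t * (q\<^sup>2 + 1) = 2 * q"
      by (simp add: q_def)
    have c: "cos (of_int (m + 1) * t) + cos (of_int (m - 1) * t) = 2 * cos (of_int m * t) * cos t"
      by (simp add: algebra_simps cos_add cos_diff)
    have "I (m + 1) (Suc (Suc n)) t + I (m - 1) (Suc (Suc n)) t + I (m + 1) n t + I (m - 1) n t
        = (cos (of_int (m + 1) * t) + cos (of_int (m - 1) * t)) * (q\<^sup>2 + 1) * q ^ n"
      unfolding I_def q_def[symmetric] by (simp add: algebra_simps power2_eq_square)
    also have "\<dots> = 2 * cos (of_int m * t) * (cos t * (q\<^sup>2 + 1)) * q ^ n"
      unfolding c by simp
    also have "\<dots> = 4 * I m (Suc n) t"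
      unfolding q by (simp add: I_def q_def)
    finally show ?thesis .
  qed
  \<comment> \<open>The pointwise identity gives two values for the same integral; they agree by
    uniqueness.\<close>
  have "((\<lambda>t. 4 * I m (Suc n) t) has_integral
      pi * discrete_poisson_kernel (Suc (Suc n)) (m + 1) + pi * discrete_poisson_kernel (Suc (Suc n)) (m - 1)
      + pi * discrete_poisson_kernel n (m + 1) + pi * discrete_poisson_kernel n (m - 1)) {0..pi}"
    by (rule has_integral_eq[OF eq]) (auto intro!: has_integral_add P)
  from has_integral_unique[OF this has_integral_mult_right[OF P]]
  have "pi * (discrete_poisson_kernel (Suc (Suc n)) (m + 1) + discrete_poisson_kernel (Suc (Suc n)) (m - 1)
      + discrete_poisson_kernel n (m + 1) + discrete_poisson_kernel n (m - 1))
      = pi * (4 * discrete_poisson_kernel (Suc n) m)"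
    by (simp add: algebra_simps)
  then show "discrete_poisson_kernel (Suc (Suc n)) (m + 1) + discrete_poisson_kernel (Suc (Suc n)) (m - 1)
      + discrete_poisson_kernel n (m + 1) + discrete_poisson_kernel n (m - 1)
      = 4 * discrete_poisson_kernel (Suc n) m"
    using pi_neq_zero by (simp only: mult_cancel_left simp_thms)
qed

section \<open>Positivity and total mass of the Poisson kernel\<close>

lemma discrete_poisson_kernel_nonneg: "discrete_poisson_kernel n m \<ge> 0"
proof (rule diag_harmonic_nonneg[where u = "\<lambda>m n. discrete_poisson_kernel n m" and B = 1])
  show "- 1 \<le> discrete_poisson_kernel n m" for m n
    using discrete_poisson_kernel_bounded[of n m] by linarith
qed (simp_all add: diag_harmonic_discrete_poisson_kernel discrete_poisson_kernel_0)

text \<open>In the boundary row the finite sum is the indicator of \<open>J\<close>, so 1 minus the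
  sum is nonnegative there, and the minimum principle extends this upwards.\<close>

lemma sum_discrete_poisson_kernel_le_1:
  assumes "finite J"
  shows "(\<Sum>j\<in>J. discrete_poisson_kernel n (m - j)) \<le> 1"
proof -
  have "1 - (\<Sum>j\<in>J. discrete_poisson_kernel n (m - j)) \<ge> 0"
  proof (rule diag_harmonic_nonneg[where B = "real (card J)"
        and u = "\<lambda>m n. 1 - (\<Sum>j\<in>J. discrete_poisson_kernel n (m - j))"])
    show "diag_harmonic (\<lambda>m n. 1 - (\<Sum>j\<in>J. discrete_poisson_kernel n (m - j)))"
      by (intro diag_harmonic_diff diag_harmonic_const diag_harmonic_sum
          diag_harmonic_translate[OF diag_harmonic_discrete_poisson_kernel])
    \<comment> \<open>Any lower bound will do for the minimum principle; this one depends on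
      \<open>J\<close>, but the conclusion does not, and so it passes to the infinite sum.\<close>
    show "- real (card J) \<le> 1 - (\<Sum>j\<in>J. discrete_poisson_kernel n (m - j))" for m n
    proof -
      have "discrete_poisson_kernel n (m - j) \<le> 1" for j
        using discrete_poisson_kernel_bounded[of n "m - j"] by linarith
      then show ?thesis
        using sum_bounded_above[of J "\<lambda>j. discrete_poisson_kernel n (m - j)" 1] by simp
    qed
    show "0 \<le> 1 - (\<Sum>j\<in>J. discrete_poisson_kernel 0 (m - j))" for m
      using assms by (simp add: discrete_poisson_kernel_0)
  qed
  then show ?thesis
    by simp
qed

lemma discrete_poisson_kernel_summable:
  "(\<lambda>j. discrete_poisson_kernel n (m - j)) summable_on UNIV"
  by (intro nonneg_bdd_above_summable_on bdd_aboveI[where M = 1])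
    (auto simp: discrete_poisson_kernel_nonneg sum_discrete_poisson_kernel_le_1)

lemma infsum_discrete_poisson_kernel_le_1:
  "(\<Sum>\<^sub>\<infinity>j. discrete_poisson_kernel n (m - j)) \<le> 1"
  by (intro infsum_le_finite_sums discrete_poisson_kernel_summable sum_discrete_poisson_kernel_le_1)

section \<open>Poisson integrals of bounded sequences\<close>

context
  fixes a :: "int \<Rightarrow> complex" and B :: real
  assumes a_bound: "\<And>j. norm (a j) \<le> B"
begin

lemma poisson_integral_norm_summable:
  "(\<lambda>j. norm (a j * of_real (discrete_poisson_kernel n (m - j)))) summable_on UNIV"
proof (rule summable_on_comparison_test)
  show "(\<lambda>j. B * discrete_poisson_kernel n (m - j)) summable_on UNIV"
    by (intro summable_on_cmult_right discrete_poisson_kernel_summable)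
qed (auto simp: norm_mult discrete_poisson_kernel_nonneg intro!: mult_right_mono a_bound)

lemma poisson_integral_summable:
  "(\<lambda>j. a j * of_real (discrete_poisson_kernel n (m - j))) summable_on UNIV"
  by (rule abs_summable_summable[OF poisson_integral_norm_summable])

lemma poisson_integral_bounded:
  "norm (\<Sum>\<^sub>\<infinity>j. a j * of_real (discrete_poisson_kernel n (m - j))) \<le> B"
proof -
  have "norm (\<Sum>\<^sub>\<infinity>j. a j * of_real (discrete_poisson_kernel n (m - j)))
      \<le> (\<Sum>\<^sub>\<infinity>j. norm (a j * of_real (discrete_poisson_kernel n (m - j))))"
    by (rule norm_infsum_bound[OF poisson_integral_norm_summable])
  also have "\<dots> \<le> (\<Sum>\<^sub>\<infinity>j. B * discrete_poisson_kernel n (m - j))"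
    by (intro infsum_mono poisson_integral_norm_summable summable_on_cmult_right
        discrete_poisson_kernel_summable)
      (auto simp: norm_mult discrete_poisson_kernel_nonneg intro!: mult_right_mono a_bound)
  also have "\<dots> = B * (\<Sum>\<^sub>\<infinity>j. discrete_poisson_kernel n (m - j))"
    by (intro infsum_cmult_right discrete_poisson_kernel_summable)
  \<comment> \<open>The mass is at most 1, and \<open>B \<ge> 0\<close> because it dominates a
    norm.\<close>
  also have "\<dots> \<le> B"
    using infsum_discrete_poisson_kernel_le_1[of n m] order_trans[OF norm_ge_zero a_bound]
    by (intro mult_left_le) auto
  finally show ?thesis .
qed

lemma poisson_integral_0: "(\<Sum>\<^sub>\<infinity>j. a j * of_real (discrete_poisson_kernel 0 (m - j))) = a m"
proof -
  have "(\<Sum>\<^sub>\<infinity>j. a j * of_real (discrete_poisson_kernel 0 (m - j)))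
      = (\<Sum>\<^sub>\<infinity>j\<in>{m}. a j * of_real (discrete_poisson_kernel 0 (m - j)))"
    by (intro infsum_cong_neutral) (auto simp: discrete_poisson_kernel_0)
  then show ?thesis
    by (simp add: discrete_poisson_kernel_0)
qed

text \<open>The mean value identity holds in each summand, since horizontal translates of the kernel
  are harmonic; convergence of all the series allows it to be summed over \<open>j\<close>.\<close>

lemma diag_harmonic_poisson_integral:
  "diag_harmonic (\<lambda>m n. \<Sum>\<^sub>\<infinity>j. a j * of_real (discrete_poisson_kernel n (m - j)))"
  unfolding diag_harmonic_def
proof (intro allI)
  fix m n
  let ?T = "\<lambda>m n j. a j * of_real (discrete_poisson_kernel n (m - j))"
  have eq: "?T (m + 1) (Suc (Suc n)) j + ?T (m - 1) (Suc (Suc n)) j + ?T (m + 1) n j + ?T (m - 1) n j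
      = 4 * ?T m (Suc n) j" for j
  proof -
    have "?T (m + 1) (Suc (Suc n)) j + ?T (m - 1) (Suc (Suc n)) j + ?T (m + 1) n j + ?T (m - 1) n j
        = a j * of_real (discrete_poisson_kernel (Suc (Suc n)) (m + 1 - j)
           + discrete_poisson_kernel (Suc (Suc n)) (m - 1 - j)
           + discrete_poisson_kernel n (m + 1 - j) + discrete_poisson_kernel n (m - 1 - j))"
      by (simp add: distrib_left)
    also have "\<dots> = a j * of_real (4 * discrete_poisson_kernel (Suc n) (m - j))"
      by (subst diag_harmonicD[OF diag_harmonic_translate[OF diag_harmonic_discrete_poisson_kernel]])
        (rule refl)
    finally show ?thesis
      by simp
  qed
  have "infsum (?T (m + 1) (Suc (Suc n))) UNIV + infsum (?T (m - 1) (Suc (Suc n))) UNIV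
      + infsum (?T (m + 1) n) UNIV + infsum (?T (m - 1) n) UNIV
      = (\<Sum>\<^sub>\<infinity>j. ?T (m + 1) (Suc (Suc n)) j + ?T (m - 1) (Suc (Suc n)) j
          + ?T (m + 1) n j + ?T (m - 1) n j)"
    by (simp only: infsum_add summable_on_add poisson_integral_summable)
  also have "\<dots> = 4 * infsum (?T m (Suc n)) UNIV"
    unfolding eq by (intro infsum_cmult_right poisson_integral_summable)
  finally show "infsum (?T (m + 1) (Suc (Suc n))) UNIV + infsum (?T (m - 1) (Suc (Suc n))) UNIV
      + infsum (?T (m + 1) n) UNIV + infsum (?T (m - 1) n) UNIV = 4 * infsum (?T m (Suc n)) UNIV" .
qed

end

section \<open>Reproduction of \<open>f\<close> from its boundary row\<close>

theorem proposition3p3: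
  fixes p :: real and f :: "int \<Rightarrow> nat \<Rightarrow> complex" and m :: int and n :: nat
  assumes "1 \<le> p"
    and "f \<in> Hp p"
  shows "((\<lambda>j. f j 0 * of_real (discrete_poisson_kernel n (m - j))) has_sum f m n) UNIV"
proof -
  obtain B where B: "\<And>m n. norm (f m n) \<le> B"
    using Hp_bounded[OF assms] by blast
  \<comment> \<open>The Poisson integral of the boundary row of \<open>f\<close>; it inherits the
    bound \<open>B\<close>, so the difference is bounded by \<open>B + B\<close>.\<close>
  define g where "g m n = (\<Sum>\<^sub>\<infinity>j. f j 0 * of_real (discrete_poisson_kernel n (m - j)))" for m n
  have "f m n - g m n = 0"
  proof (rule diag_harmonic_eq_0[where u = "\<lambda>m n. f m n - g m n"])
    show "diag_harmonic (\<lambda>m n. f m n - g m n)"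
      using assms(2) unfolding g_def Hp_def
      by (intro diag_harmonic_diff Hol_Z2_plus_diag_harmonic diag_harmonic_poisson_integral[OF B]) simp
    show "norm (f m n - g m n) \<le> B + B" for m n
      unfolding g_def by (intro norm_triangle_le_diff add_mono B poisson_integral_bounded)
    show "f m 0 - g m 0 = 0" for m
      unfolding g_def by (simp add: poisson_integral_0[OF B])
  qed
  then show ?thesis
    \<comment> \<open>Since \<open>infsum\<close> defaults to 0 on divergent families, the value of
      \<open>g\<close> is paired with summability to obtain \<open>has_sum\<close>.\<close>
    using has_sum_infsum[OF poisson_integral_summable[of "\<lambda>j. f j 0" B n m, OF B]]
    by (simp add: g_def)
qed

end
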